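(* For a $G$-$A$-coring with a fixed grouplike family $(\underline{\mathcal C},\underline x)$, the following statements are equivalent: (1) $(\underline{\mathcal C},\underline x)$ is a Galois group coring; (2) $(\underline{\mathcal C},\underline x)$ is a cofree group coring with a fixed grouplike family, and $(\mathcal C_e,x_e)$ is a Galois coring.
   Context: $G$ is a group with unit $e$, $A$ is a ring with unit. A $G$-$A$-coring (group coring) $\underline{\mathcal C}$ is a family $(\mathcal C_\alpha)_{\alpha\in G}$ of $A$-bimodules with $A$-bimodule maps $\Delta_{\alpha,\beta}:\mathcal C_{\alpha\beta}\to\mathcal C_\alpha\otimes_A\mathcal C_\beta$ and $\varepsilon:\mathcal C_e\to A$ such that, for all $\alpha,\beta,\gamma\in G$, $(\Delta_{\alpha,\beta}\otimes_A\mathcal C_\gamma)\circ\Delta_{\alpha\beta,\gamma}=(\mathcal C_\alpha\otimes_A\Delta_{\beta,\gamma})\circ\Delta_{\alpha,\beta\gamma}$ and $(\mathcal C_\alpha\otimes_A\varepsilon)\circ\Delta_{\alpha,e}=\mathcal C_\alpha=(\varepsilon\otimes_A\mathcal C_\alpha)\circ\Delta_{e,\alpha}$ (an object also denotes its identity map). $\mathcal C_e$ is an $A$-coring with comultiplication $\Delta_{e,e}(c)=c_{(1)}\otimes_Ac_{(2)}$ and counit $\varepsilon$. A morphism of $G$-$A$-corings is a family of bimodule maps $f_\alpha$ with $(f_\alpha\otimes_Af_\beta)\circ\Delta_{\alpha,\beta}=\Delta_{\alpha,\beta}\circ f_{\alpha\beta}$ and $\varepsilon\circ f_e=\varepsilon$.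 A grouplike family is $\underline x=(x_\alpha)_{\alpha\in G}\in\prod_\alpha\mathcal C_\alpha$ with $\Delta_{\alpha,\beta}(x_{\alpha\beta})=x_\alpha\otimes_Ax_\beta$ and $\varepsilon(x_e)=1$. Put $T=A^{\mathrm{co}\,\underline{\mathcal C}}=\{a\in A\mid ax_\alpha=x_\alpha a\ \forall\alpha\in G\}$ and $T_e=A^{\mathrm{co}\,\mathcal C_e}=\{a\in A\mid ax_e=x_ea\}$. $(\underline{\mathcal C},\underline x)$ is a cofree group coring with a fixed grouplike family if there exist $A$-bimodule isomorphisms $\gamma_\alpha:\mathcal C_e\to\mathcal C_\alpha$ ($\alpha\in G$) with $\Delta_{\alpha,\beta}(\gamma_{\alpha\beta}(c))=\gamma_\alpha(c_{(1)})\otimes_A\gamma_\beta(c_{(2)})$ for all $c\in\mathcal C_e$, and $x_\alpha=\gamma_\alpha(x_e)$ for all $\alpha\in G$. $(\mathcal C_e,x_e)$ is a Galois coring if $\mathrm{can}:A\otimes_{T_e}A\to\mathcal C_e$, $a\otimes b\mapsto ax_eb$, is an isomorphism of corings, where $A\otimes_{T_e}A$ is the Sweedler canonical coring: $\Delta(a\otimes b)=(a\otimes1)\otimes_A(1\otimes b)$, $\varepsilon(a\otimes b)=ab$. $(\underline{\mathcal C},\underline x)$ is Galois if $\underline{\mathrm{can}}:\underline{\mathcal D}\to\underline{\mathcal C}$, $\mathrm{can}_\alpha(\mu_\alpha(a\otimes_Tb))=ax_\alpha b$, is an isomorphism of group corings, where $\underline{\mathcal D}=(A\otimes_TA)\langle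 G\rangle=(\mu_\alpha(A\otimes_TA))_{\alpha\in G}$ ($\mu_\alpha(M)$ is a copy of $M$ indexed by $\alpha$) has $\Delta_{\alpha,\beta}(\mu_{\alpha\beta}(a\otimes_Tb))=\mu_\alpha(a\otimes_T1)\otimes_A\mu_\beta(1\otimes_Tb)$ and $\varepsilon(\mu_e(a\otimes_Tb))=ab$. *)

theory Defs
  imports "HOL-Algebra.Algebra"
begin

section \<open>Bimodules over arbitrary rings\<close>

text \<open>
  A bimodule is an HOL-Algebra module record together with a right action. As for \<open>module\<close>,
  the fields \<open>mult\<close> and \<open>one\<close> inherited from \<open>ring\<close> carry no meaning.
\<close>

record ('a, 'm) bimodule = "('a, 'm) module" +
  rsmult :: "['m, 'a] \<Rightarrow> 'm" (infixl "\<lhd>\<index>" 70)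

locale bimodule = R?: ring R + S?: ring S + M?: abelian_group M
  for R :: "'a ring" and S :: "'a ring" and M :: "('a, 'm) bimodule" (structure) +
  assumes smult_closed [simp, intro]:
      "\<lbrakk> r \<in> carrier R; m \<in> carrier M \<rbrakk> \<Longrightarrow> r \<odot> m \<in> carrier M"
    and smult_l_distr:
      "\<lbrakk> r \<in> carrier R; r' \<in> carrier R; m \<in> carrier M \<rbrakk> \<Longrightarrow>
        (r \<oplus>\<^bsub>R\<^esub> r') \<odot> m = r \<odot> m \<oplus> r' \<odot> m"
    and smult_r_distr:
      "\<lbrakk> r \<in> carrier R; m \<in> carrier M; m' \<in> carrier M \<rbrakk> \<Longrightarrow>
        r \<odot> (m \<oplus> m') = r \<odot> m \<oplus> r \<odot> m'"
    and smult_assoc: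
      "\<lbrakk> r \<in> carrier R; r' \<in> carrier R; m \<in> carrier M \<rbrakk> \<Longrightarrow>
        (r \<otimes>\<^bsub>R\<^esub> r') \<odot> m = r \<odot> (r' \<odot> m)"
    and smult_one [simp]: "m \<in> carrier M \<Longrightarrow> \<one>\<^bsub>R\<^esub> \<odot> m = m"
    and rsmult_closed [simp, intro]:
      "\<lbrakk> s \<in> carrier S; m \<in> carrier M \<rbrakk> \<Longrightarrow> m \<lhd> s \<in> carrier M"
    and rsmult_l_distr:
      "\<lbrakk> s \<in> carrier S; m \<in> carrier M; m' \<in> carrier M \<rbrakk> \<Longrightarrow>
        (m \<oplus> m') \<lhd> s = m \<lhd> s \<oplus> m' \<lhd> s"
    and rsmult_r_distr:
      "\<lbrakk> s \<in> carrier S; s' \<in> carrier S; m \<in> carrier M \<rbrakk> \<Longrightarrow>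
        m \<lhd> (s \<oplus>\<^bsub>S\<^esub> s') = m \<lhd> s \<oplus> m \<lhd> s'"
    and rsmult_assoc:
      "\<lbrakk> s \<in> carrier S; s' \<in> carrier S; m \<in> carrier M \<rbrakk> \<Longrightarrow>
        m \<lhd> (s \<otimes>\<^bsub>S\<^esub> s') = (m \<lhd> s) \<lhd> s'"
    and rsmult_one [simp]: "m \<in> carrier M \<Longrightarrow> m \<lhd> \<one>\<^bsub>S\<^esub> = m"
    and smult_rsmult:
      "\<lbrakk> r \<in> carrier R; s \<in> carrier S; m \<in> carrier M \<rbrakk> \<Longrightarrow>
        (r \<odot> m) \<lhd> s = r \<odot> (m \<lhd> s)"

definition bimodule_hom ::
  "'a ring \<Rightarrow> 'a ring \<Rightarrow> ('a, 'm) bimodule \<Rightarrow> ('a, 'n) bimodule \<Rightarrow> ('m \<Rightarrow> 'n) set" where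
  "bimodule_hom R S M N = {f \<in> carrier M \<rightarrow> carrier N.
     (\<forall>m\<in>carrier M. \<forall>m'\<in>carrier M. f (m \<oplus>\<^bsub>M\<^esub> m') = f m \<oplus>\<^bsub>N\<^esub> f m') \<and>
     (\<forall>r\<in>carrier R. \<forall>m\<in>carrier M. f (r \<odot>\<^bsub>M\<^esub> m) = r \<odot>\<^bsub>N\<^esub> f m) \<and>
     (\<forall>s\<in>carrier S. \<forall>m\<in>carrier M. f (m \<lhd>\<^bsub>M\<^esub> s) = f m \<lhd>\<^bsub>N\<^esub> s)}"

definition bimodule_iso ::
  "'a ring \<Rightarrow> 'a ring \<Rightarrow> ('a, 'm) bimodule \<Rightarrow> ('a, 'n) bimodule \<Rightarrow> ('m \<Rightarrow> 'n) set" where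
  "bimodule_iso R S M N = {f \<in> bimodule_hom R S M N. bij_betw f (carrier M) (carrier N)}"

text \<open>A ring as a bimodule over itself, and over any of its subrings.\<close>

definition regular_bimodule :: "'a ring \<Rightarrow> ('a, 'a) bimodule" where
  "regular_bimodule A =
    \<lparr>carrier = carrier A, monoid.mult = monoid.mult A, one = one A,
     ring.zero = ring.zero A, ring.add = ring.add A,
     smult = monoid.mult A, rsmult = monoid.mult A\<rparr>"


section \<open>Tensor products over a noncommutative ring\<close>

text \<open>
  \<open>M \<otimes>\<^sub>S N\<close> is the free abelian group on \<open>M \<times> N\<close> modulo the subgroup generated by the usual
  relators; its elements are cosets. The outer actions come from \<open>M\<close> on the left and
  from \<open>N\<close> on the right, so no rings other than \<open>S\<close> need to be mentioned.
\<close>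

type_synonym ('m, 'n) tensor = "('m \<times> 'n \<Rightarrow>\<^sub>0 int) set"

definition tensor_relators ::
  "'a ring \<Rightarrow> ('a, 'm) bimodule \<Rightarrow> ('a, 'n) bimodule \<Rightarrow> ('m \<times> 'n \<Rightarrow>\<^sub>0 int) set" where
  "tensor_relators S M N =
     {frag_of (m \<oplus>\<^bsub>M\<^esub> m', n) - frag_of (m, n) - frag_of (m', n) | m m' n.
        m \<in> carrier M \<and> m' \<in> carrier M \<and> n \<in> carrier N} \<union>
     {frag_of (m, n \<oplus>\<^bsub>N\<^esub> n') - frag_of (m, n) - frag_of (m, n') | m n n'.
        m \<in> carrier M \<and> n \<in> carrier N \<and> n' \<in> carrier N} \<union>
     {frag_of (m \<lhd>\<^bsub>M\<^esub> s, n) - frag_of (m, s \<odot>\<^bsub>N\<^esub> n) | m s n.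
        m \<in> carrier M \<and> s \<in> carrier S \<and> n \<in> carrier N}"

definition tensor_kernel ::
  "'a ring \<Rightarrow> ('a, 'm) bimodule \<Rightarrow> ('a, 'n) bimodule \<Rightarrow> ('m \<times> 'n \<Rightarrow>\<^sub>0 int) set" where
  "tensor_kernel S M N =
     generate (free_Abelian_group (carrier M \<times> carrier N)) (tensor_relators S M N)"

definition tensor_elem ::
  "'a ring \<Rightarrow> ('a, 'm) bimodule \<Rightarrow> ('a, 'n) bimodule \<Rightarrow> 'm \<Rightarrow> 'n \<Rightarrow> ('m, 'n) tensor" where
  "tensor_elem S M N m n =
     tensor_kernel S M N #>\<^bsub>free_Abelian_group (carrier M \<times> carrier N)\<^esub> frag_of (m, n)"

definition tensor_group ::
  "'a ring \<Rightarrow> ('a, 'm) bimodule \<Rightarrow> ('a, 'n) bimodule \<Rightarrow> ('m, 'n) tensor ring" where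
  "tensor_group S M N =
    (let Q = free_Abelian_group (carrier M \<times> carrier N) Mod tensor_kernel S M N
     in \<lparr>carrier = carrier Q, monoid.mult = undefined, one = undefined,
         ring.zero = one Q, ring.add = monoid.mult Q\<rparr>)"

text \<open>
  For a balanced biadditive map \<open>h\<close> into an abelian group \<open>P\<close>, \<open>tensor_lift P h\<close> is the
  induced additive map out of the tensor product, \<open>m \<otimes> n \<mapsto> h m n\<close>: the additive extension of
  \<open>h\<close> to the free abelian group is constant on each coset. Nothing is claimed about it if
  \<open>h\<close> is not balanced and biadditive.
\<close>

definition free_extend ::
  "('p, 'z) ring_scheme \<Rightarrow> ('m \<Rightarrow> 'n \<Rightarrow> 'p) \<Rightarrow> ('m \<times> 'n \<Rightarrow>\<^sub>0 int) \<Rightarrow> 'p" where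
  "free_extend P h u =
     (\<Oplus>\<^bsub>P\<^esub> p \<in> Poly_Mapping.keys u. add_pow P (Poly_Mapping.lookup u p) (h (fst p) (snd p)))"

definition tensor_lift ::
  "('p, 'z) ring_scheme \<Rightarrow> ('m \<Rightarrow> 'n \<Rightarrow> 'p) \<Rightarrow> ('m, 'n) tensor \<Rightarrow> 'p" where
  "tensor_lift P h t = the_elem (free_extend P h ` t)"

definition tensor_bimodule ::
  "'a ring \<Rightarrow> ('a, 'm) bimodule \<Rightarrow> ('a, 'n) bimodule \<Rightarrow> ('a, ('m, 'n) tensor) bimodule" where
  "tensor_bimodule S M N =
    (let P = tensor_group S M N
     in \<lparr>carrier = carrier P, monoid.mult = monoid.mult P, one = one P,
         ring.zero = ring.zero P, ring.add = ring.add P,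
         smult = (\<lambda>r. tensor_lift P (\<lambda>m n. tensor_elem S M N (r \<odot>\<^bsub>M\<^esub> m) n)),
         rsmult = (\<lambda>t s. tensor_lift P (\<lambda>m n. tensor_elem S M N m (n \<lhd>\<^bsub>N\<^esub> s)) t)\<rparr>)"

text \<open>The map \<open>f \<otimes>\<^sub>S g\<close> into \<open>M' \<otimes>\<^sub>S N'\<close>.\<close>

definition tensor_map ::
  "'a ring \<Rightarrow> ('a, 'm1) bimodule \<Rightarrow> ('a, 'n1) bimodule \<Rightarrow>
   ('m \<Rightarrow> 'm1) \<Rightarrow> ('n \<Rightarrow> 'n1) \<Rightarrow> ('m, 'n) tensor \<Rightarrow> ('m1, 'n1) tensor" where
  "tensor_map S M' N' f g =
     tensor_lift (tensor_bimodule S M' N') (\<lambda>m n. tensor_elem S M' N' (f m) (g n))"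

text \<open>
  The canonical maps \<open>(M \<otimes>\<^sub>S N) \<otimes>\<^sub>S P \<rightarrow> M \<otimes>\<^sub>S (N \<otimes>\<^sub>S P)\<close>, \<open>M \<otimes>\<^sub>S S \<rightarrow> M\<close> and \<open>S \<otimes>\<^sub>S M \<rightarrow> M\<close>,
  left implicit on paper.
\<close>

definition tensor_assoc ::
  "'a ring \<Rightarrow> ('a, 'm) bimodule \<Rightarrow> ('a, 'n) bimodule \<Rightarrow> ('a, 'p) bimodule \<Rightarrow>
   (('m, 'n) tensor, 'p) tensor \<Rightarrow> ('m, ('n, 'p) tensor) tensor" where
  "tensor_assoc S M N P =
    (let NP = tensor_bimodule S N P; M_NP = tensor_bimodule S M NP
     in tensor_lift M_NP
          (\<lambda>t p. tensor_lift M_NP (\<lambda>m n. tensor_elem S M NP m (tensor_elem S N P n p)) t))"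

definition tensor_runit :: "('a, 'm) bimodule \<Rightarrow> ('m, 'a) tensor \<Rightarrow> 'm" where
  "tensor_runit M = tensor_lift M (\<lambda>m a. m \<lhd>\<^bsub>M\<^esub> a)"

definition tensor_lunit :: "('a, 'm) bimodule \<Rightarrow> ('a, 'm) tensor \<Rightarrow> 'm" where
  "tensor_lunit M = tensor_lift M (\<lambda>a m. a \<odot>\<^bsub>M\<^esub> m)"


section \<open>Corings and group corings\<close>

record ('a, 'c) coring =
  cobimod :: "('a, 'c) bimodule"
  comult :: "'c \<Rightarrow> ('c, 'c) tensor"
  counit :: "'c \<Rightarrow> 'a"

text \<open>
  A family \<open>(C\<^sub>\<alpha>)\<close> of bimodules over a common element type is no restriction: the carriers
  may be chosen as arbitrary, for example disjoint, subsets of it.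
\<close>

record ('g, 'a, 'c) group_coring =
  gcomponent :: "'g \<Rightarrow> ('a, 'c) bimodule"
  gcomult :: "'g \<Rightarrow> 'g \<Rightarrow> 'c \<Rightarrow> ('c, 'c) tensor"
  gcounit :: "'c \<Rightarrow> 'a"

locale group_coring = G?: group G + A?: ring A
  for G :: "'g monoid" and A :: "'a ring" and C :: "('g, 'a, 'c) group_coring" +
  assumes component_bimodule:
      "\<alpha> \<in> carrier G \<Longrightarrow> bimodule A A (gcomponent C \<alpha>)"
    and comult_hom:
      "\<lbrakk> \<alpha> \<in> carrier G; \<beta> \<in> carrier G \<rbrakk> \<Longrightarrow>
        gcomult C \<alpha> \<beta> \<in> bimodule_hom A A (gcomponent C (\<alpha> \<otimes>\<^bsub>G\<^esub> \<beta>))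
          (tensor_bimodule A (gcomponent C \<alpha>) (gcomponent C \<beta>))"
    and counit_hom:
      "gcounit C \<in> bimodule_hom A A (gcomponent C \<one>\<^bsub>G\<^esub>) (regular_bimodule A)"
    and coassoc:
      "\<lbrakk> \<alpha> \<in> carrier G; \<beta> \<in> carrier G; \<gamma> \<in> carrier G;
         c \<in> carrier (gcomponent C (\<alpha> \<otimes>\<^bsub>G\<^esub> \<beta> \<otimes>\<^bsub>G\<^esub> \<gamma>)) \<rbrakk> \<Longrightarrow>
        tensor_assoc A (gcomponent C \<alpha>) (gcomponent C \<beta>) (gcomponent C \<gamma>)
          (tensor_map A (tensor_bimodule A (gcomponent C \<alpha>) (gcomponent C \<beta>)) (gcomponent C \<gamma>)
             (gcomult C \<alpha> \<beta>) (\<lambda>c. c) (gcomult C (\<alpha> \<otimes>\<^bsub>G\<^esub> \<beta>) \<gamma> c)) =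
        tensor_map A (gcomponent C \<alpha>) (tensor_bimodule A (gcomponent C \<beta>) (gcomponent C \<gamma>))
          (\<lambda>c. c) (gcomult C \<beta> \<gamma>) (gcomult C \<alpha> (\<beta> \<otimes>\<^bsub>G\<^esub> \<gamma>) c)"
    and counit_right:
      "\<lbrakk> \<alpha> \<in> carrier G; c \<in> carrier (gcomponent C \<alpha>) \<rbrakk> \<Longrightarrow>
        tensor_runit (gcomponent C \<alpha>)
          (tensor_map A (gcomponent C \<alpha>) (regular_bimodule A)
             (\<lambda>c. c) (gcounit C) (gcomult C \<alpha> \<one>\<^bsub>G\<^esub> c)) = c"
    and counit_left:
      "\<lbrakk> \<alpha> \<in> carrier G; c \<in> carrier (gcomponent C \<alpha>) \<rbrakk> \<Longrightarrow>
        tensor_lunit (gcomponent C \<alpha>)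
          (tensor_map A (regular_bimodule A) (gcomponent C \<alpha>)
             (gcounit C) (\<lambda>c. c) (gcomult C \<one>\<^bsub>G\<^esub> \<alpha> c)) = c"

definition coring_iso ::
  "'a ring \<Rightarrow> ('a, 'c) coring \<Rightarrow> ('a, 'd) coring \<Rightarrow> ('c \<Rightarrow> 'd) \<Rightarrow> bool" where
  "coring_iso A C D f \<longleftrightarrow>
     f \<in> bimodule_iso A A (cobimod C) (cobimod D) \<and>
     (\<forall>c\<in>carrier (cobimod C).
        tensor_map A (cobimod D) (cobimod D) f f (comult C c) = comult D (f c) \<and>
        counit D (f c) = counit C c)"

definition group_coring_iso ::
  "'g monoid \<Rightarrow> 'a ring \<Rightarrow> ('g, 'a, 'c) group_coring \<Rightarrow> ('g, 'a, 'd) group_coring \<Rightarrow>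
   ('g \<Rightarrow> 'c \<Rightarrow> 'd) \<Rightarrow> bool" where
  "group_coring_iso G A C D f \<longleftrightarrow>
     (\<forall>\<alpha>\<in>carrier G. f \<alpha> \<in> bimodule_iso A A (gcomponent C \<alpha>) (gcomponent D \<alpha>)) \<and>
     (\<forall>\<alpha>\<in>carrier G. \<forall>\<beta>\<in>carrier G. \<forall>c\<in>carrier (gcomponent C (\<alpha> \<otimes>\<^bsub>G\<^esub> \<beta>)).
        tensor_map A (gcomponent D \<alpha>) (gcomponent D \<beta>) (f \<alpha>) (f \<beta>) (gcomult C \<alpha> \<beta> c) =
        gcomult D \<alpha> \<beta> (f (\<alpha> \<otimes>\<^bsub>G\<^esub> \<beta>) c)) \<and>
     (\<forall>c\<in>carrier (gcomponent C \<one>\<^bsub>G\<^esub>). gcounit D (f \<one>\<^bsub>G\<^esub> c) = gcounit C c)"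

text \<open>The \<open>A\<close>-coring \<open>C\<^sub>e\<close>.\<close>

definition unit_coring :: "'g monoid \<Rightarrow> ('g, 'a, 'c) group_coring \<Rightarrow> ('a, 'c) coring" where
  "unit_coring G C =
    \<lparr>cobimod = gcomponent C \<one>\<^bsub>G\<^esub>, comult = gcomult C \<one>\<^bsub>G\<^esub> \<one>\<^bsub>G\<^esub>, counit = gcounit C\<rparr>"


section \<open>Grouplike families, cofree and Galois group corings\<close>

definition grouplike_family ::
  "'g monoid \<Rightarrow> 'a ring \<Rightarrow> ('g, 'a, 'c) group_coring \<Rightarrow> ('g \<Rightarrow> 'c) \<Rightarrow> bool" where
  "grouplike_family G A C x \<longleftrightarrow>
     (\<forall>\<alpha>\<in>carrier G. x \<alpha> \<in> carrier (gcomponent C \<alpha>)) \<and>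
     (\<forall>\<alpha>\<in>carrier G. \<forall>\<beta>\<in>carrier G.
        gcomult C \<alpha> \<beta> (x (\<alpha> \<otimes>\<^bsub>G\<^esub> \<beta>)) =
        tensor_elem A (gcomponent C \<alpha>) (gcomponent C \<beta>) (x \<alpha>) (x \<beta>)) \<and>
     gcounit C (x \<one>\<^bsub>G\<^esub>) = \<one>\<^bsub>A\<^esub>"

text \<open>The subrings of coinvariants \<open>T\<close> and \<open>T\<^sub>e\<close> of \<open>A\<close>.\<close>

definition group_coinvariants ::
  "'g monoid \<Rightarrow> 'a ring \<Rightarrow> ('g, 'a, 'c) group_coring \<Rightarrow> ('g \<Rightarrow> 'c) \<Rightarrow> 'a ring" where
  "group_coinvariants G A C x =
     A\<lparr>carrier := {a \<in> carrier A.
        \<forall>\<alpha>\<in>carrier G. a \<odot>\<^bsub>gcomponent C \<alpha>\<^esub> x \<alpha> = x \<alpha> \<lhd>\<^bsub>gcomponent C \<alpha>\<^esub> a}\<rparr>"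

definition coinvariants :: "'a ring \<Rightarrow> ('a, 'c) coring \<Rightarrow> 'c \<Rightarrow> 'a ring" where
  "coinvariants A C x =
     A\<lparr>carrier := {a \<in> carrier A. a \<odot>\<^bsub>cobimod C\<^esub> x = x \<lhd>\<^bsub>cobimod C\<^esub> a}\<rparr>"

definition cofree_group_coring ::
  "'g monoid \<Rightarrow> 'a ring \<Rightarrow> ('g, 'a, 'c) group_coring \<Rightarrow> ('g \<Rightarrow> 'c) \<Rightarrow> bool" where
  "cofree_group_coring G A C x \<longleftrightarrow>
     (\<exists>\<gamma>. (\<forall>\<alpha>\<in>carrier G. \<gamma> \<alpha> \<in> bimodule_iso A A (gcomponent C \<one>\<^bsub>G\<^esub>) (gcomponent C \<alpha>)) \<and>
       (\<forall>\<alpha>\<in>carrier G. \<forall>\<beta>\<in>carrier G. \<forall>c\<in>carrier (gcomponent C \<one>\<^bsub>G\<^esub>).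
          gcomult C \<alpha> \<beta> (\<gamma> (\<alpha> \<otimes>\<^bsub>G\<^esub> \<beta>) c) =
          tensor_map A (gcomponent C \<alpha>) (gcomponent C \<beta>) (\<gamma> \<alpha>) (\<gamma> \<beta>)
            (gcomult C \<one>\<^bsub>G\<^esub> \<one>\<^bsub>G\<^esub> c)) \<and>
       (\<forall>\<alpha>\<in>carrier G. x \<alpha> = \<gamma> \<alpha> (x \<one>\<^bsub>G\<^esub>)))"

text \<open>The Sweedler canonical coring \<open>A \<otimes>\<^sub>S A\<close> of a subring \<open>S\<close> of \<open>A\<close>.\<close>

definition sweedler_coring :: "'a ring \<Rightarrow> 'a ring \<Rightarrow> ('a, ('a, 'a) tensor) coring" where
  "sweedler_coring A S =
    (let AA = regular_bimodule A; D = tensor_bimodule S AA AA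
     in \<lparr>cobimod = D,
         comult = tensor_lift (tensor_bimodule A D D)
           (\<lambda>a b. tensor_elem A D D (tensor_elem S AA AA a \<one>\<^bsub>A\<^esub>) (tensor_elem S AA AA \<one>\<^bsub>A\<^esub> b)),
         counit = tensor_lift A (\<lambda>a b. a \<otimes>\<^bsub>A\<^esub> b)\<rparr>)"

text \<open>
  The group coring \<open>D\<langle>G\<rangle>\<close>. A copy \<open>\<mu>\<^sub>\<alpha>(D)\<close> of \<open>D\<close> is \<open>D\<close> itself in position \<open>\<alpha>\<close>
  of the family, so that every \<open>\<mu>\<^sub>\<alpha>\<close> is the identity map.
\<close>

definition coring_copies :: "('a, 'c) coring \<Rightarrow> ('g, 'a, 'c) group_coring" where
  "coring_copies D =
    \<lparr>gcomponent = (\<lambda>_. cobimod D), gcomult = (\<lambda>_ _. comult D), gcounit = counit D\<rparr>"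

text \<open>The maps \<open>a \<otimes> b \<mapsto> a x b\<close> into a bimodule \<open>M\<close>.\<close>

definition can_map :: "('a, 'm) bimodule \<Rightarrow> 'm \<Rightarrow> ('a, 'a) tensor \<Rightarrow> 'm" where
  "can_map M x = tensor_lift M (\<lambda>a b. (a \<odot>\<^bsub>M\<^esub> x) \<lhd>\<^bsub>M\<^esub> b)"

definition galois_coring :: "'a ring \<Rightarrow> ('a, 'c) coring \<Rightarrow> 'c \<Rightarrow> bool" where
  "galois_coring A C x \<longleftrightarrow>
     coring_iso A (sweedler_coring A (coinvariants A C x)) C (can_map (cobimod C) x)"

definition galois_group_coring ::
  "'g monoid \<Rightarrow> 'a ring \<Rightarrow> ('g, 'a, 'c) group_coring \<Rightarrow> ('g \<Rightarrow> 'c) \<Rightarrow> bool" where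
  "galois_group_coring G A C x \<longleftrightarrow>
     group_coring_iso G A (coring_copies (sweedler_coring A (group_coinvariants G A C x))) C
       (\<lambda>\<alpha>. can_map (gcomponent C \<alpha>) (x \<alpha>))"

end

theory Submission
  imports Defs
begin

text \<open>
  Everything rests on the identity \<open>can\<^sub>\<alpha> = \<gamma>\<^sub>\<alpha> \<circ> can\<^sub>e\<close> on \<open>A \<otimes>\<^sub>T A\<close>, which ties the canonical maps to the
  isomorphisms \<open>\<gamma>\<^sub>\<alpha>\<close> of a cofree structure. For a cofree family it holds because \<open>\<gamma>\<^sub>\<alpha>\<close> is a bimodule map with
  \<open>\<gamma>\<^sub>\<alpha>(x\<^sub>e) = x\<^sub>\<alpha>\<close>, so that \<open>\<gamma>\<^sub>\<alpha>(a x\<^sub>e b) = a x\<^sub>\<alpha> b\<close> (\<open>can_map_natural\<close>). For a Galois group coring it is taken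
  as the definition \<open>\<gamma>\<^sub>\<alpha> = can\<^sub>\<alpha> \<circ> can\<^sub>e\<^sup>-\<^sup>1\<close>, and \<open>\<gamma>\<^sub>\<alpha>(x\<^sub>e) = x\<^sub>\<alpha>\<close> follows since \<open>can\<^sub>\<alpha>(1 \<otimes> 1) = x\<^sub>\<alpha>\<close> for every \<open>\<alpha>\<close>.

  Given the identity, and given that \<open>can\<^sub>e\<close> respects the comultiplications, functoriality of the tensor
  product (\<open>tensor_map_comp\<close>) gives
  \<open>(\<gamma>\<^sub>\<alpha> \<otimes> \<gamma>\<^sub>\<beta>) (\<Delta> (can\<^sub>e d)) = (\<gamma>\<^sub>\<alpha> \<otimes> \<gamma>\<^sub>\<beta>) ((can\<^sub>e \<otimes> can\<^sub>e) (\<Delta> d)) = (can\<^sub>\<alpha> \<otimes> can\<^sub>\<beta>) (\<Delta> d)\<close>, where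
  the left-hand \<open>\<Delta>\<close> is that of \<open>C\<^sub>e\<close>. As \<open>can\<^sub>e\<close> is bijective, the family \<open>\<gamma>\<close> is therefore compatible with
  the comultiplications if and only if the family \<open>can\<close> is.

  A Galois coring \<open>C\<^sub>e\<close> refers to \<open>A \<otimes> A\<close> over \<open>T\<^sub>e\<close>, a Galois group coring to \<open>A \<otimes> A\<close> over \<open>T\<close>. In the presence
  of a cofree structure the two subrings coincide (\<open>cofree_coinvariants\<close>), so both conditions speak of the
  same Sweedler coring and of the same counit condition.

  What makes these arguments rigorous is the universal property of the tensor product: lifts of balanced
  maps are well defined (\<open>tensor_lift_coset\<close>), and additive maps that agree on pure tensors are equal
  (\<open>additive_maps_eqI\<close>). In particular, the comultiplication of the Sweedler coring is well defined with
  values in \<open>D \<otimes>\<^sub>A D\<close> (\<open>comult_balanced\<close>), as functoriality requires.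
\<close>

section \<open>The universal property of the tensor product\<close>

abbreviation additive_maps ::
  "('m, 'y) ring_scheme \<Rightarrow> ('n, 'z) ring_scheme \<Rightarrow> ('m \<Rightarrow> 'n) set" where
  "additive_maps M N \<equiv> hom (add_monoid M) (add_monoid N)"

lemma additive_mapsI:
  assumes "\<And>m. m \<in> carrier M \<Longrightarrow> f m \<in> carrier N"
    and "\<And>m m'. \<lbrakk>m \<in> carrier M; m' \<in> carrier M\<rbrakk> \<Longrightarrow> f (m \<oplus>\<^bsub>M\<^esub> m') = f m \<oplus>\<^bsub>N\<^esub> f m'"
  shows "f \<in> additive_maps M N"
  using assms by (auto simp: hom_def)

lemma additive_maps_closed: "\<lbrakk>f \<in> additive_maps M N; m \<in> carrier M\<rbrakk> \<Longrightarrow> f m \<in> carrier N"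
  by (auto simp: hom_def)

lemma additive_maps_add:
  "\<lbrakk>f \<in> additive_maps M N; m \<in> carrier M; m' \<in> carrier M\<rbrakk> \<Longrightarrow> f (m \<oplus>\<^bsub>M\<^esub> m') = f m \<oplus>\<^bsub>N\<^esub> f m'"
  by (auto simp: hom_def)

text \<open>
  The generators \<open>frag_of p\<close> determine a homomorphism, since every element is an iterated
  difference of them.
\<close>

lemma hom_free_Abelian_group_eqI:
  assumes "group H" "f \<in> hom (free_Abelian_group B) H" "g \<in> hom (free_Abelian_group B) H"
    and gen: "\<And>p. p \<in> B \<Longrightarrow> f (frag_of p) = g (frag_of p)"
    and u: "u \<in> carrier (free_Abelian_group B)"
  shows "f u = g u"
proof -
  interpret f: group_hom "free_Abelian_group B" H f
    using assms by (simp add: group_hom_def group_hom_axioms_def)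
  interpret g: group_hom "free_Abelian_group B" H g
    using assms by (simp add: group_hom_def group_hom_axioms_def)
  have "Poly_Mapping.keys u \<subseteq> B" using u by simp
  then have "Poly_Mapping.keys u \<subseteq> B \<and> f u = g u"
  proof (induction rule: frag_induction)
    case zero
    show ?case using f.hom_one g.hom_one by simp
  next
    case (one p)
    then show ?case by (simp add: gen)
  next
    case (diff a b)
    then have "a \<in> carrier (free_Abelian_group B)" "b \<in> carrier (free_Abelian_group B)" by simp_all
    then have "f (a \<otimes>\<^bsub>free_Abelian_group B\<^esub> inv\<^bsub>free_Abelian_group B\<^esub> b) =
        g (a \<otimes>\<^bsub>free_Abelian_group B\<^esub> inv\<^bsub>free_Abelian_group B\<^esub> b)"
      using diff by (simp only: f.hom_mult g.hom_mult f.hom_inv g.hom_inv f.G.inv_closed)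
    moreover have "Poly_Mapping.keys (a - b) \<subseteq> B" using diff keys_diff[of a b] by blast
    ultimately show ?case using diff by simp
  qed
  then show ?thesis by simp
qed

text \<open>
  Over any finite set containing the support, the sum defining the extension has the same value:
  the extra terms have coefficient \<open>0\<close>. So the values at \<open>u\<close>, \<open>v\<close> and \<open>u + v\<close> may all be computed
  over the union of the two supports, where they can be compared term by term.
\<close>

lemma free_extend_hom:
  assumes P: "abelian_group P"
    and h: "\<And>m n. (m, n) \<in> B \<Longrightarrow> h m n \<in> carrier P"
  shows "free_extend P h \<in> hom (free_Abelian_group B) (add_monoid P)"
proof -
  interpret P: abelian_group P by fact
  let ?t = "\<lambda>u p. add_pow P (Poly_Mapping.lookup u p :: int) (h (fst p) (snd p))"
  have ext: "free_extend P h u = finsum P (?t u) K"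
    if "finite K" "Poly_Mapping.keys u \<subseteq> K" "K \<subseteq> B" for u K
    unfolding free_extend_def
    using that by (intro P.add.finprod_mono_neutral_cong_left)
      (auto simp: in_keys_iff add_pow_def intro!: P.add.int_pow_closed[unfolded add_pow_def] h)
  show ?thesis
  proof (rule homI)
    fix u assume "u \<in> carrier (free_Abelian_group B)"
    then show "free_extend P h u \<in> carrier (add_monoid P)"
      using h by (auto simp: free_extend_def intro!: P.finsum_closed P.add.int_pow_closed)
  next
    fix u v assume uv: "u \<in> carrier (free_Abelian_group B)" "v \<in> carrier (free_Abelian_group B)"
    let ?K = "Poly_Mapping.keys u \<union> Poly_Mapping.keys v"
    have K: "finite ?K" "?K \<subseteq> B" using uv by auto
    have hK: "h (fst p) (snd p) \<in> carrier P" if "p \<in> ?K" for p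
      using h K that by auto
    have "free_extend P h (u + v) = finsum P (?t (u + v)) ?K"
      using K by (intro ext Poly_Mapping.keys_add)
    also have "\<dots> = (\<Oplus>\<^bsub>P\<^esub>p\<in>?K. ?t u p \<oplus>\<^bsub>P\<^esub> ?t v p)"
      using hK by (intro P.finsum_cong')
        (auto simp: Poly_Mapping.lookup_add P.add.int_pow_mult intro!: P.add.int_pow_closed)
    also have "\<dots> = finsum P (?t u) ?K \<oplus>\<^bsub>P\<^esub> finsum P (?t v) ?K"
      using hK by (intro P.finsum_addf) (auto intro!: P.add.int_pow_closed)
    also have "\<dots> = free_extend P h u \<oplus>\<^bsub>P\<^esub> free_extend P h v"
      using K ext[of ?K u] ext[of ?K v] by auto
    finally show "free_extend P h (u \<otimes>\<^bsub>free_Abelian_group B\<^esub> v) =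
        free_extend P h u \<otimes>\<^bsub>add_monoid P\<^esub> free_extend P h v"
      by simp
  qed
qed

lemma free_extend_frag_of:
  assumes "abelian_group P" "h m n \<in> carrier P"
  shows "free_extend P h (frag_of (m, n)) = h m n"
proof -
  interpret P: abelian_group P by fact
  show ?thesis using assms(2)
    by (simp add: free_extend_def P.add.int_pow_1)
qed

lemma free_Abelian_group_diff_closed:
  "\<lbrakk>u \<in> carrier (free_Abelian_group B); v \<in> carrier (free_Abelian_group B)\<rbrakk> \<Longrightarrow>
    u - v \<in> carrier (free_Abelian_group B)"
  using keys_diff[of u v] by auto

lemma free_Abelian_group_add_closed:
  "\<lbrakk>u \<in> carrier (free_Abelian_group B); v \<in> carrier (free_Abelian_group B)\<rbrakk> \<Longrightarrow>
    u + v \<in> carrier (free_Abelian_group B)"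
  using Poly_Mapping.keys_add[of u v] by auto

text \<open>
  The form in which a homomorphism is seen to kill a relator of the tensor product: the additivity
  relators are of the shape \<open>u - v - w\<close>, and the balancing relators are the case \<open>w = 0\<close>.
\<close>

lemma group_hom_diff_eq_one:
  assumes "f \<in> hom (free_Abelian_group B) H" "group H"
    and "Poly_Mapping.keys u \<subseteq> B" "Poly_Mapping.keys v \<subseteq> B" "Poly_Mapping.keys w \<subseteq> B"
    and "f u = f v \<otimes>\<^bsub>H\<^esub> f w"
  shows "f (u - v - w) = \<one>\<^bsub>H\<^esub>"
proof -
  interpret f: group_hom "free_Abelian_group B" H f
    using assms by (simp add: group_hom_def group_hom_axioms_def)
  let ?F = "free_Abelian_group B"
  have vw: "Poly_Mapping.keys (v + w) \<subseteq> B" using assms(4,5) Poly_Mapping.keys_add[of v w] by blast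
  have "u \<in> carrier ?F" "v \<in> carrier ?F" "w \<in> carrier ?F" using assms(3-5) by simp_all
  then have "f (u \<otimes>\<^bsub>?F\<^esub> inv\<^bsub>?F\<^esub> (v \<otimes>\<^bsub>?F\<^esub> w)) = f u \<otimes>\<^bsub>H\<^esub> inv\<^bsub>H\<^esub> (f v \<otimes>\<^bsub>H\<^esub> f w)"
    by (simp only: f.hom_mult f.hom_inv f.G.inv_closed f.G.m_closed)
  also have "\<dots> = \<one>\<^bsub>H\<^esub>"
    using assms(4-6) f.hom_closed by (simp add: f.H.r_inv)
  finally show ?thesis using vw
    by (simp only: mult_free_Abelian_group inv_free_Abelian_group add_uminus_conv_diff diff_diff_eq)
qed

text \<open>
  Closure of the carriers under the two inner actions keeps the relators inside the free abelian group
  on \<open>M \<times> N\<close>. Stated at this generality, the universal property covers both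
  \<open>A \<otimes>\<^sub>T A\<close> for a subset \<open>T\<close> of \<open>A\<close> and \<open>D \<otimes>\<^sub>A D\<close> for \<open>D = A \<otimes>\<^sub>T A\<close>.
\<close>

locale middle_pair = M?: abelian_group M + N?: abelian_group N
  for S :: "'a ring" and M :: "('a, 'm) bimodule" and N :: "('a, 'n) bimodule" +
  assumes inner_rsmult_closed: "\<lbrakk>s \<in> carrier S; m \<in> carrier M\<rbrakk> \<Longrightarrow> m \<lhd>\<^bsub>M\<^esub> s \<in> carrier M"
    and inner_smult_closed: "\<lbrakk>s \<in> carrier S; n \<in> carrier N\<rbrakk> \<Longrightarrow> s \<odot>\<^bsub>N\<^esub> n \<in> carrier N"
begin

abbreviation "F \<equiv> free_Abelian_group (carrier M \<times> carrier N)"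
abbreviation "K \<equiv> tensor_kernel S M N"
abbreviation "MN \<equiv> tensor_bimodule S M N"
abbreviation coset where "coset u \<equiv> K #>\<^bsub>F\<^esub> u"

lemma relators_subset: "tensor_relators S M N \<subseteq> carrier F"
  unfolding tensor_relators_def
  by (auto simp del: carrier_free_Abelian_group_iff
      intro!: free_Abelian_group_diff_closed inner_rsmult_closed inner_smult_closed)

lemma kernel_normal: "K \<lhd> F"
  unfolding tensor_kernel_def
  using relators_subset
  by (intro comm_group.subgroup_imp_normal abelian_free_Abelian_group
      group.generate_is_subgroup group_free_Abelian_group)

text \<open>
  The additive monoid of the record \<open>MN\<close> and the quotient group \<open>F Mod K\<close> have different types
  (the first carries along the extra record fields), so the two are compared field by field.
\<close>

lemma tensor_sel:
  "carrier MN = carrier (F Mod K)"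
  "x \<oplus>\<^bsub>MN\<^esub> y = x \<otimes>\<^bsub>F Mod K\<^esub> y"
  "\<zero>\<^bsub>MN\<^esub> = \<one>\<^bsub>F Mod K\<^esub>"
  by (simp_all add: tensor_bimodule_def tensor_group_def Let_def)

lemma abelian_group_tensor: "abelian_group MN"
proof -
  have "comm_group (F Mod K)"
    by (intro comm_group.abelian_FactGroup abelian_free_Abelian_group
        normal_imp_subgroup kernel_normal)
  note * = comm_groupE[OF this]
  show ?thesis
    by (rule abelian_groupI) (use * in \<open>simp_all only: tensor_sel\<close>)
qed

lemma tensor_carrierE:
  assumes "t \<in> carrier MN"
  obtains u where "u \<in> carrier F" "t = coset u"
  using assms that by (auto simp: tensor_sel carrier_FactGroup)

lemma coset_closed: "u \<in> carrier F \<Longrightarrow> coset u \<in> carrier MN"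
  by (auto simp: tensor_sel carrier_FactGroup)

lemma coset_add: "\<lbrakk>u \<in> carrier F; v \<in> carrier F\<rbrakk> \<Longrightarrow> coset u \<oplus>\<^bsub>MN\<^esub> coset v = coset (u + v)"
  using normal.rcos_sum[OF kernel_normal, of u v] by (simp add: tensor_sel)

lemma coset_eqI:
  assumes "u \<in> carrier F" "v \<in> carrier F" "u - v \<in> K"
  shows "coset u = coset v"
proof -
  have "subgroup K F" by (rule normal_imp_subgroup[OF kernel_normal])
  moreover have "u \<in> coset v"
    using assms(3) by (auto simp: r_coset_def intro!: bexI[of _ "u - v"])
  ultimately show ?thesis
    using group.repr_independence[of F u K v] assms(2) by simp
qed

lemma relator_in_kernel: "r \<in> tensor_relators S M N \<Longrightarrow> r \<in> K"
  by (simp add: tensor_kernel_def generate.incl)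

lemma tensor_elem_closed: "\<lbrakk>m \<in> carrier M; n \<in> carrier N\<rbrakk> \<Longrightarrow> tensor_elem S M N m n \<in> carrier MN"
  unfolding tensor_elem_def by (rule coset_closed) simp

lemma tensor_elem_add_left:
  assumes "m \<in> carrier M" "m' \<in> carrier M" "n \<in> carrier N"
  shows "tensor_elem S M N (m \<oplus>\<^bsub>M\<^esub> m') n = tensor_elem S M N m n \<oplus>\<^bsub>MN\<^esub> tensor_elem S M N m' n"
proof -
  have "frag_of (m \<oplus>\<^bsub>M\<^esub> m', n) - frag_of (m, n) - frag_of (m', n) \<in> K"
    using assms by (intro relator_in_kernel) (auto simp: tensor_relators_def)
  then have "coset (frag_of (m \<oplus>\<^bsub>M\<^esub> m', n)) = coset (frag_of (m, n) + frag_of (m', n))"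
    using assms by (intro coset_eqI free_Abelian_group_add_closed) (auto simp: diff_diff_eq)
  also have "\<dots> = coset (frag_of (m, n)) \<oplus>\<^bsub>MN\<^esub> coset (frag_of (m', n))"
    using assms by (intro coset_add[symmetric]) auto
  finally show ?thesis by (simp add: tensor_elem_def)
qed

lemma tensor_elem_add_right:
  assumes "m \<in> carrier M" "n \<in> carrier N" "n' \<in> carrier N"
  shows "tensor_elem S M N m (n \<oplus>\<^bsub>N\<^esub> n') = tensor_elem S M N m n \<oplus>\<^bsub>MN\<^esub> tensor_elem S M N m n'"
proof -
  have "frag_of (m, n \<oplus>\<^bsub>N\<^esub> n') - frag_of (m, n) - frag_of (m, n') \<in> K"
    using assms by (intro relator_in_kernel) (auto simp: tensor_relators_def)
  then have "coset (frag_of (m, n \<oplus>\<^bsub>N\<^esub> n')) = coset (frag_of (m, n) + frag_of (m, n'))"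
    using assms by (intro coset_eqI free_Abelian_group_add_closed) (auto simp: diff_diff_eq)
  also have "\<dots> = coset (frag_of (m, n)) \<oplus>\<^bsub>MN\<^esub> coset (frag_of (m, n'))"
    using assms by (intro coset_add[symmetric]) auto
  finally show ?thesis by (simp add: tensor_elem_def)
qed

lemma tensor_elem_balanced:
  assumes "m \<in> carrier M" "s \<in> carrier S" "n \<in> carrier N"
  shows "tensor_elem S M N (m \<lhd>\<^bsub>M\<^esub> s) n = tensor_elem S M N m (s \<odot>\<^bsub>N\<^esub> n)"
proof -
  have "frag_of (m \<lhd>\<^bsub>M\<^esub> s, n) - frag_of (m, s \<odot>\<^bsub>N\<^esub> n) \<in> K"
    using assms by (intro relator_in_kernel) (auto simp: tensor_relators_def)
  then show ?thesis
    unfolding tensor_elem_def using assms inner_rsmult_closed inner_smult_closed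
    by (intro coset_eqI) auto
qed

end

text \<open>
  The maps \<open>M \<times> N \<rightarrow> P\<close> that the tensor product classifies.
\<close>

definition balanced_map ::
  "'a ring \<Rightarrow> ('a, 'm) bimodule \<Rightarrow> ('a, 'n) bimodule \<Rightarrow> ('p, 'z) ring_scheme \<Rightarrow> ('m \<Rightarrow> 'n \<Rightarrow> 'p) \<Rightarrow> bool" where
  "balanced_map S M N P h \<longleftrightarrow>
     (\<forall>m\<in>carrier M. \<forall>n\<in>carrier N. h m n \<in> carrier P) \<and>
     (\<forall>m\<in>carrier M. \<forall>m'\<in>carrier M. \<forall>n\<in>carrier N. h (m \<oplus>\<^bsub>M\<^esub> m') n = h m n \<oplus>\<^bsub>P\<^esub> h m' n) \<and>
     (\<forall>m\<in>carrier M. \<forall>n\<in>carrier N. \<forall>n'\<in>carrier N. h m (n \<oplus>\<^bsub>N\<^esub> n') = h m n \<oplus>\<^bsub>P\<^esub> h m n') \<and>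
     (\<forall>m\<in>carrier M. \<forall>s\<in>carrier S. \<forall>n\<in>carrier N. h (m \<lhd>\<^bsub>M\<^esub> s) n = h m (s \<odot>\<^bsub>N\<^esub> n))"

context middle_pair
begin

lemma free_extend_kernel:
  assumes P: "abelian_group P" and h: "balanced_map S M N P h" and k: "k \<in> K"
  shows "free_extend P h k = \<zero>\<^bsub>P\<^esub>"
proof -
  interpret P: abelian_group P by fact
  have hc: "\<And>m n. \<lbrakk>m \<in> carrier M; n \<in> carrier N\<rbrakk> \<Longrightarrow> h m n \<in> carrier P"
    using h by (simp add: balanced_map_def)
  have hom: "free_extend P h \<in> hom F (add_monoid P)"
    using P hc by (intro free_extend_hom) auto
  then interpret fe: group_hom F "add_monoid P" "free_extend P h"
    by (simp add: group_hom_def group_hom_axioms_def P.a_group)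
  note fo = free_extend_frag_of[OF P, of h, OF hc]
  have *: "free_extend P h (frag_of p - frag_of q - frag_of r) = \<zero>\<^bsub>P\<^esub>"
    if "p \<in> carrier M \<times> carrier N" "q \<in> carrier M \<times> carrier N" "r \<in> carrier M \<times> carrier N"
      "free_extend P h (frag_of p) = free_extend P h (frag_of q) \<oplus>\<^bsub>P\<^esub> free_extend P h (frag_of r)" for p q r
    using group_hom_diff_eq_one[OF hom P.a_group, of "frag_of p" "frag_of q" "frag_of r"] that by simp
  have **: "free_extend P h (frag_of p - frag_of q) = \<zero>\<^bsub>P\<^esub>"
    if "p \<in> carrier M \<times> carrier N" "q \<in> carrier M \<times> carrier N"
      "free_extend P h (frag_of p) = free_extend P h (frag_of q)" for p q
    using group_hom_diff_eq_one[OF hom P.a_group, of "frag_of p" "frag_of q" 0] that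
      fe.hom_one P.r_zero fe.hom_closed[of "frag_of q"] by simp
  have "tensor_relators S M N \<subseteq> kernel F (add_monoid P) (free_extend P h)"
  proof
    fix r assume r: "r \<in> tensor_relators S M N"
    then have "free_extend P h r = \<zero>\<^bsub>P\<^esub>"
      unfolding tensor_relators_def
      using h inner_rsmult_closed inner_smult_closed
      by (auto intro!: * ** simp: fo balanced_map_def)
    then show "r \<in> kernel F (add_monoid P) (free_extend P h)"
      using r relators_subset by (auto simp: kernel_def simp del: carrier_free_Abelian_group_iff)
  qed
  then have "K \<subseteq> kernel F (add_monoid P) (free_extend P h)"
    unfolding tensor_kernel_def by (intro fe.G.generate_subgroup_incl fe.subgroup_kernel)
  then show ?thesis using k by (auto simp: kernel_def)
qed

text \<open>
  The extension of a balanced map kills the kernel, hence is constant on each coset, so that the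
  image of the coset is a singleton and \<open>the_elem\<close> picks its value at any representative.
\<close>

lemma tensor_lift_coset:
  assumes P: "abelian_group P" and h: "balanced_map S M N P h" and u: "u \<in> carrier F"
  shows "tensor_lift P h (coset u) = free_extend P h u"
proof -
  interpret P: abelian_group P by fact
  have hom: "free_extend P h \<in> hom F (add_monoid P)"
    using P h by (intro free_extend_hom) (auto simp: balanced_map_def)
  have K: "K \<subseteq> carrier F" "0 \<in> K"
    using normal_imp_subgroup[OF kernel_normal] subgroup.subset subgroup.one_closed by fastforce+
  have eq: "free_extend P h v = free_extend P h u" if "v \<in> coset u" for v
  proof -
    obtain k where k: "k \<in> K" "v = k + u" using \<open>v \<in> coset u\<close> by (auto simp: r_coset_def)
    then have "free_extend P h v = free_extend P h k \<oplus>\<^bsub>P\<^esub> free_extend P h u"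
      using hom_mult[OF hom, of k u] K u by auto
    also have "\<dots> = free_extend P h u"
      using free_extend_kernel[OF P h k(1)] hom_in_carrier[OF hom u] by simp
    finally show ?thesis .
  qed
  have "u \<in> coset u" using K by (auto simp: r_coset_def intro!: bexI[of _ 0])
  then have "free_extend P h u \<in> free_extend P h ` coset u" by (rule imageI)
  moreover have "free_extend P h ` coset u \<subseteq> {free_extend P h u}"
    by (rule image_subsetI) (simp only: eq singletonI)
  ultimately have "free_extend P h ` coset u = {free_extend P h u}"
    by (simp only: subset_singleton_iff) (erule disjE, simp_all only: empty_iff)
  then show ?thesis by (simp only: tensor_lift_def the_elem_eq)
qed

lemma tensor_lift_additive:
  assumes P: "abelian_group P" and h: "balanced_map S M N P h"
  shows "tensor_lift P h \<in> additive_maps MN P"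
proof -
  have hom: "free_extend P h \<in> hom F (add_monoid P)"
    using P h by (intro free_extend_hom) (auto simp: balanced_map_def)
  show ?thesis
  proof (rule additive_mapsI)
    fix s assume "s \<in> carrier MN"
    then show "tensor_lift P h s \<in> carrier P"
      by (elim tensor_carrierE) (use hom_in_carrier[OF hom] in \<open>auto simp: tensor_lift_coset[OF P h]\<close>)
  next
    fix s t assume "s \<in> carrier MN" "t \<in> carrier MN"
    then obtain u v where uv: "u \<in> carrier F" "v \<in> carrier F" "s = coset u" "t = coset v"
      by (metis tensor_carrierE)
    have "u + v \<in> carrier F" using uv(1,2) Poly_Mapping.keys_add[of u v] by auto
    then show "tensor_lift P h (s \<oplus>\<^bsub>MN\<^esub> t) = tensor_lift P h s \<oplus>\<^bsub>P\<^esub> tensor_lift P h t"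
      using hom_mult[OF hom uv(1,2)] uv by (simp only: coset_add tensor_lift_coset[OF P h]) simp
  qed
qed

lemma tensor_lift_elem:
  assumes P: "abelian_group P" and h: "balanced_map S M N P h" and mn: "m \<in> carrier M" "n \<in> carrier N"
  shows "tensor_lift P h (tensor_elem S M N m n) = h m n"
proof -
  have "h m n \<in> carrier P" using h mn by (simp add: balanced_map_def)
  moreover have "frag_of (m, n) \<in> carrier F" using mn by simp
  ultimately show ?thesis
    unfolding tensor_elem_def by (simp only: tensor_lift_coset[OF P h] free_extend_frag_of[OF P])
qed

text \<open>
  Pure tensors generate the tensor product as a group. All identities of maps out of tensor products
  below are reduced to pure tensors in this way.
\<close>

lemma additive_maps_eqI:
  assumes P: "abelian_group P"
    and f: "f \<in> additive_maps MN P" and g: "g \<in> additive_maps MN P"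
    and eq: "\<And>m n. \<lbrakk>m \<in> carrier M; n \<in> carrier N\<rbrakk> \<Longrightarrow>
      f (tensor_elem S M N m n) = g (tensor_elem S M N m n)"
    and t: "t \<in> carrier MN"
  shows "f t = g t"
proof -
  obtain u where u: "u \<in> carrier F" "t = coset u" by (rule tensor_carrierE[OF t])
  have hom: "(\<lambda>u. k (coset u)) \<in> hom F (add_monoid P)" if k: "k \<in> additive_maps MN P" for k
  proof (rule homI)
    fix u v assume "u \<in> carrier F" "v \<in> carrier F"
    then show "k (coset (u \<otimes>\<^bsub>F\<^esub> v)) = k (coset u) \<otimes>\<^bsub>add_monoid P\<^esub> k (coset v)"
      using additive_maps_add[OF k coset_closed coset_closed]
      by (simp only: mult_free_Abelian_group coset_add[symmetric] monoid.simps)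
  next
    fix u assume "u \<in> carrier F"
    then show "k (coset u) \<in> carrier (add_monoid P)"
      using additive_maps_closed[OF k coset_closed] by (simp only: partial_object.simps)
  qed
  have eq': "f (coset (frag_of p)) = g (coset (frag_of p))" if "p \<in> carrier M \<times> carrier N" for p
    using that eq[of "fst p" "snd p"] by (simp add: tensor_elem_def mem_Times_iff)
  show ?thesis
    unfolding u(2)
    by (rule hom_free_Abelian_group_eqI[OF abelian_group.a_group[OF P] hom[OF f] hom[OF g] eq' u(1)])
qed

end

section \<open>Maps between tensor products\<close>

lemma bimodule_hom_additive: "f \<in> bimodule_hom R S M N \<Longrightarrow> f \<in> additive_maps M N"
  by (auto simp: bimodule_hom_def hom_def)

lemma bimodule_hom_closed: "\<lbrakk>f \<in> bimodule_hom R S M N; m \<in> carrier M\<rbrakk> \<Longrightarrow> f m \<in> carrier N"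
  by (auto simp: bimodule_hom_def)

lemma bimodule_middle_pair:
  assumes "bimodule R S M" "bimodule S R' N"
  shows "middle_pair S M N"
proof -
  interpret M: bimodule R S M by fact
  interpret N: bimodule S R' N by fact
  show ?thesis by unfold_locales auto
qed

lemma tensor_map_balanced:
  assumes "middle_pair S M' N'"
    and f: "f \<in> bimodule_hom R S M M'" and g: "g \<in> bimodule_hom S R' N N'"
  shows "balanced_map S M N (tensor_bimodule S M' N') (\<lambda>m n. tensor_elem S M' N' (f m) (g n))"
proof -
  interpret T: middle_pair S M' N' by fact
  show ?thesis
    using f g
    unfolding balanced_map_def bimodule_hom_def
    by (auto simp: T.tensor_elem_closed T.tensor_elem_add_left T.tensor_elem_add_right
        T.tensor_elem_balanced Pi_iff)
qed

lemma tensor_map_additive: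
  assumes "middle_pair S M N" "middle_pair S M' N'"
    and "f \<in> bimodule_hom R S M M'" "g \<in> bimodule_hom S R' N N'"
  shows "tensor_map S M' N' f g \<in> additive_maps (tensor_bimodule S M N) (tensor_bimodule S M' N')"
  unfolding tensor_map_def
  using assms by (intro middle_pair.tensor_lift_additive middle_pair.abelian_group_tensor tensor_map_balanced)

lemma tensor_map_elem:
  assumes "middle_pair S M N" "middle_pair S M' N'"
    and "f \<in> bimodule_hom R S M M'" "g \<in> bimodule_hom S R' N N'"
    and "m \<in> carrier M" "n \<in> carrier N"
  shows "tensor_map S M' N' f g (tensor_elem S M N m n) = tensor_elem S M' N' (f m) (g n)"
  unfolding tensor_map_def
  by (rule middle_pair.tensor_lift_elem[OF assms(1) middle_pair.abelian_group_tensor[OF assms(2)]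
      tensor_map_balanced[OF assms(2-4)] assms(5,6)])

text \<open>
  Functoriality of the tensor product. The composites are allowed to agree with the third pair of maps
  only on the carriers, because a bimodule map is unconstrained outside of its carrier.
\<close>

lemma tensor_map_comp:
  assumes p1: "middle_pair S M N" and p2: "middle_pair S M' N'" and p3: "middle_pair S M'' N''"
    and f: "f \<in> bimodule_hom R S M M'" and g: "g \<in> bimodule_hom S R' N N'"
    and f': "f' \<in> bimodule_hom R S M' M''" and g': "g' \<in> bimodule_hom S R' N' N''"
    and f'': "f'' \<in> bimodule_hom R S M M''" and g'': "g'' \<in> bimodule_hom S R' N N''"
    and ff: "\<And>m. m \<in> carrier M \<Longrightarrow> f' (f m) = f'' m"
    and gg: "\<And>n. n \<in> carrier N \<Longrightarrow> g' (g n) = g'' n"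
    and t: "t \<in> carrier (tensor_bimodule S M N)"
  shows "tensor_map S M'' N'' f' g' (tensor_map S M' N' f g t) = tensor_map S M'' N'' f'' g'' t"
proof -
  note add1 = tensor_map_additive[OF p1 p2 f g] and add2 = tensor_map_additive[OF p2 p3 f' g']
  have "(\<lambda>t. tensor_map S M'' N'' f' g' (tensor_map S M' N' f g t))
      \<in> additive_maps (tensor_bimodule S M N) (tensor_bimodule S M'' N'')"
    using additive_maps_closed[OF add1] additive_maps_closed[OF add2]
      additive_maps_add[OF add1] additive_maps_add[OF add2]
    by (intro additive_mapsI) simp_all
  then show ?thesis
  proof (rule middle_pair.additive_maps_eqI[OF p1 middle_pair.abelian_group_tensor[OF p3]
      _ tensor_map_additive[OF p1 p3 f'' g''] _ t])
    fix m n assume "m \<in> carrier M" "n \<in> carrier N"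
    then show "tensor_map S M'' N'' f' g' (tensor_map S M' N' f g (tensor_elem S M N m n)) =
        tensor_map S M'' N'' f'' g'' (tensor_elem S M N m n)"
      using bimodule_hom_closed[OF f] bimodule_hom_closed[OF g]
      by (simp add: tensor_map_elem[OF p1 p2 f g] tensor_map_elem[OF p2 p3 f' g']
          tensor_map_elem[OF p1 p3 f'' g''] ff gg)
  qed
qed

section \<open>The Sweedler coring and its canonical maps\<close>

text \<open>
  The bimodule \<open>D = A \<otimes>\<^sub>T A\<close> underlying the Sweedler coring.
\<close>

locale sweedler = A?: ring A for A :: "'a ring" and T :: "'a ring" +
  assumes T_subset: "carrier T \<subseteq> carrier A"
begin

abbreviation "AA \<equiv> regular_bimodule A"
abbreviation "D \<equiv> tensor_bimodule T AA AA"
abbreviation pure (infixl "\<boxtimes>" 70) where "a \<boxtimes> b \<equiv> tensor_elem T AA AA a b"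

lemma AA_sel [simp]:
  "carrier AA = carrier A" "a \<oplus>\<^bsub>AA\<^esub> b = a \<oplus>\<^bsub>A\<^esub> b"
  "a \<odot>\<^bsub>AA\<^esub> b = a \<otimes>\<^bsub>A\<^esub> b" "rsmult AA a b = a \<otimes>\<^bsub>A\<^esub> b" "\<zero>\<^bsub>AA\<^esub> = \<zero>\<^bsub>A\<^esub>"
  by (simp_all add: regular_bimodule_def)

lemma middle_pair_AA: "middle_pair T AA AA"
proof -
  have "abelian_group AA"
    using abelian_groupE[OF A.abelian_group_axioms] by (intro abelian_groupI) simp_all
  then show ?thesis
    using T_subset by (auto simp: middle_pair_def middle_pair_axioms_def)
qed

sublocale AA: middle_pair T AA AA by (rule middle_pair_AA)

lemma pure_add_left:
  "\<lbrakk>a \<in> carrier A; a' \<in> carrier A; b \<in> carrier A\<rbrakk> \<Longrightarrow> (a \<oplus>\<^bsub>A\<^esub> a') \<boxtimes> b = a \<boxtimes> b \<oplus>\<^bsub>D\<^esub> a' \<boxtimes> b"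
  using AA.tensor_elem_add_left by simp

lemma pure_add_right:
  "\<lbrakk>a \<in> carrier A; b \<in> carrier A; b' \<in> carrier A\<rbrakk> \<Longrightarrow> a \<boxtimes> (b \<oplus>\<^bsub>A\<^esub> b') = a \<boxtimes> b \<oplus>\<^bsub>D\<^esub> a \<boxtimes> b'"
  using AA.tensor_elem_add_right by simp

lemma pure_balanced:
  "\<lbrakk>a \<in> carrier A; t \<in> carrier T; b \<in> carrier A\<rbrakk> \<Longrightarrow> (a \<otimes>\<^bsub>A\<^esub> t) \<boxtimes> b = a \<boxtimes> (t \<otimes>\<^bsub>A\<^esub> b)"
  using AA.tensor_elem_balanced by simp

lemma pure_closed [simp]: "\<lbrakk>a \<in> carrier A; b \<in> carrier A\<rbrakk> \<Longrightarrow> a \<boxtimes> b \<in> carrier D"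
  using AA.tensor_elem_closed by simp

lemma T_mem: "t \<in> carrier T \<Longrightarrow> t \<in> carrier A"
  using T_subset by blast

lemma smult_balanced: "r \<in> carrier A \<Longrightarrow> balanced_map T AA AA D (\<lambda>a b. (r \<odot>\<^bsub>AA\<^esub> a) \<boxtimes> b)"
  by (auto simp: balanced_map_def A.r_distr pure_add_left pure_add_right pure_balanced
      A.m_assoc[symmetric] T_mem)

lemma rsmult_balanced: "r \<in> carrier A \<Longrightarrow> balanced_map T AA AA D (\<lambda>a b. a \<boxtimes> (b \<lhd>\<^bsub>AA\<^esub> r))"
  by (auto simp: balanced_map_def A.l_distr pure_add_left pure_add_right pure_balanced
      A.m_assoc T_mem)

text \<open>
  The two actions on \<open>D\<close> are lifts into the record \<open>tensor_group\<close>, which differs from \<open>D\<close> in type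
  and has no actions, although the additive groups coincide. Together with \<open>lift_to_D\<close>, these
  equations move the universal property across that difference.
\<close>

lemma D_sel:
  "carrier (tensor_group T AA AA) = carrier D"
  "add (tensor_group T AA AA) = add D"
  "ring.zero (tensor_group T AA AA) = ring.zero D"
  "smult D r = tensor_lift (tensor_group T AA AA) (\<lambda>a b. (r \<odot>\<^bsub>AA\<^esub> a) \<boxtimes> b)"
  "rsmult D t r = tensor_lift (tensor_group T AA AA) (\<lambda>a b. a \<boxtimes> (b \<lhd>\<^bsub>AA\<^esub> r)) t"
  by (simp_all add: tensor_bimodule_def Let_def)

lemma abelian_group_tensor_group: "abelian_group (tensor_group T AA AA)"
  by (rule abelian_groupI)
    (use abelian_groupE[OF AA.abelian_group_tensor] in \<open>simp_all only: D_sel\<close>)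

lemma lift_to_D:
  assumes "balanced_map T AA AA D h"
  shows "tensor_lift (tensor_group T AA AA) h \<in> additive_maps D D"
    and "\<lbrakk>a \<in> carrier A; b \<in> carrier A\<rbrakk> \<Longrightarrow> tensor_lift (tensor_group T AA AA) h (a \<boxtimes> b) = h a b"
proof -
  have h: "balanced_map T AA AA (tensor_group T AA AA) h"
    using assms by (simp only: balanced_map_def D_sel)
  show "tensor_lift (tensor_group T AA AA) h \<in> additive_maps D D"
    using AA.tensor_lift_additive[OF abelian_group_tensor_group h] by (simp add: hom_def D_sel(1-3))
  show "\<lbrakk>a \<in> carrier A; b \<in> carrier A\<rbrakk> \<Longrightarrow> tensor_lift (tensor_group T AA AA) h (a \<boxtimes> b) = h a b"
    using AA.tensor_lift_elem[OF abelian_group_tensor_group h] by simp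
qed

lemma smult_pure:
  "\<lbrakk>r \<in> carrier A; a \<in> carrier A; b \<in> carrier A\<rbrakk> \<Longrightarrow> r \<odot>\<^bsub>D\<^esub> (a \<boxtimes> b) = (r \<otimes>\<^bsub>A\<^esub> a) \<boxtimes> b"
  by (simp add: D_sel(4) lift_to_D(2)[OF smult_balanced, simplified])

lemma rsmult_pure:
  "\<lbrakk>r \<in> carrier A; a \<in> carrier A; b \<in> carrier A\<rbrakk> \<Longrightarrow> rsmult D (a \<boxtimes> b) r = a \<boxtimes> (b \<otimes>\<^bsub>A\<^esub> r)"
  by (simp add: D_sel(5) lift_to_D(2)[OF rsmult_balanced, simplified])

lemma D_smult_closed: "\<lbrakk>r \<in> carrier A; t \<in> carrier D\<rbrakk> \<Longrightarrow> r \<odot>\<^bsub>D\<^esub> t \<in> carrier D"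
  unfolding D_sel(4) by (rule additive_maps_closed[OF lift_to_D(1)[OF smult_balanced]])

lemma D_rsmult_closed: "\<lbrakk>r \<in> carrier A; t \<in> carrier D\<rbrakk> \<Longrightarrow> rsmult D t r \<in> carrier D"
  unfolding D_sel(5) by (rule additive_maps_closed[OF lift_to_D(1)[OF rsmult_balanced]])

sublocale DD: middle_pair A D D
  using AA.abelian_group_tensor D_smult_closed D_rsmult_closed
  by (simp add: middle_pair_def middle_pair_axioms_def)

text \<open>
  An element \<open>t\<close> of \<open>T\<close> passes from one side to the other through the middle tensor sign:
  \<open>(a t \<otimes> 1) \<otimes> (1 \<otimes> b) = (a \<otimes> 1) t \<otimes> (1 \<otimes> b) = (a \<otimes> 1) \<otimes> t (1 \<otimes> b) = (a \<otimes> 1) \<otimes> (1 \<otimes> t b)\<close>. The outer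
  steps move \<open>t\<close> across the tensor sign of \<open>D\<close>, the middle one across that of \<open>D \<otimes>\<^sub>A D\<close>.
\<close>

lemma comult_balanced:
  "balanced_map T AA AA (tensor_bimodule A D D)
     (\<lambda>a b. tensor_elem A D D (a \<boxtimes> \<one>\<^bsub>A\<^esub>) (\<one>\<^bsub>A\<^esub> \<boxtimes> b))"
proof -
  have "tensor_elem A D D ((a \<otimes>\<^bsub>A\<^esub> t) \<boxtimes> \<one>\<^bsub>A\<^esub>) (\<one>\<^bsub>A\<^esub> \<boxtimes> b) =
      tensor_elem A D D (a \<boxtimes> \<one>\<^bsub>A\<^esub>) (\<one>\<^bsub>A\<^esub> \<boxtimes> (t \<otimes>\<^bsub>A\<^esub> b))"
    if abt: "a \<in> carrier A" "b \<in> carrier A" "t \<in> carrier T" for a b t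
  proof -
    have t: "t \<in> carrier A" using abt(3) by (rule T_mem)
    have "(a \<otimes>\<^bsub>A\<^esub> t) \<boxtimes> \<one>\<^bsub>A\<^esub> = rsmult D (a \<boxtimes> \<one>\<^bsub>A\<^esub>) t"
      using abt t by (simp add: rsmult_pure pure_balanced)
    moreover have "t \<odot>\<^bsub>D\<^esub> (\<one>\<^bsub>A\<^esub> \<boxtimes> b) = \<one>\<^bsub>A\<^esub> \<boxtimes> (t \<otimes>\<^bsub>A\<^esub> b)"
      using abt t pure_balanced[of "\<one>\<^bsub>A\<^esub>" t b] by (simp add: smult_pure)
    ultimately show ?thesis
      using abt t DD.tensor_elem_balanced[of "a \<boxtimes> \<one>\<^bsub>A\<^esub>" t "\<one>\<^bsub>A\<^esub> \<boxtimes> b"] by simp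
  qed
  then show ?thesis
    by (auto simp: balanced_map_def pure_add_left pure_add_right DD.tensor_elem_closed
        DD.tensor_elem_add_left DD.tensor_elem_add_right)
qed

lemma cobimod_sweedler: "cobimod (sweedler_coring A T) = D"
  by (simp add: sweedler_coring_def Let_def)

lemma comult_closed:
  assumes "d \<in> carrier D"
  shows "comult (sweedler_coring A T) d \<in> carrier (tensor_bimodule A D D)"
proof -
  have "comult (sweedler_coring A T) = tensor_lift (tensor_bimodule A D D)
      (\<lambda>a b. tensor_elem A D D (a \<boxtimes> \<one>\<^bsub>A\<^esub>) (\<one>\<^bsub>A\<^esub> \<boxtimes> b))"
    by (simp add: sweedler_coring_def Let_def)
  then show ?thesis
    using additive_maps_closed[OF AA.tensor_lift_additive[OF DD.abelian_group_tensor comult_balanced] assms]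
    by simp
qed

text \<open>
  Commutation of \<open>x\<close> with \<open>T\<close> is what makes \<open>a \<otimes> b \<mapsto> a x b\<close> well defined over \<open>T\<close>:
  \<open>(a t) x b = a (t x) b = a (x t) b = (a x) (t b)\<close>.
\<close>

lemma can_map_balanced:
  assumes M: "bimodule A A M" and x: "x \<in> carrier M"
    and comm: "\<And>t. t \<in> carrier T \<Longrightarrow> t \<odot>\<^bsub>M\<^esub> x = rsmult M x t"
  shows "balanced_map T AA AA M (\<lambda>a b. rsmult M (a \<odot>\<^bsub>M\<^esub> x) b)"
proof -
  interpret M: bimodule A A M by fact
  have "rsmult M ((a \<otimes>\<^bsub>A\<^esub> t) \<odot>\<^bsub>M\<^esub> x) b = rsmult M (a \<odot>\<^bsub>M\<^esub> x) (t \<otimes>\<^bsub>A\<^esub> b)"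
    if "a \<in> carrier A" "t \<in> carrier T" "b \<in> carrier A" for a t b
    using that T_mem[OF that(2)] x
    by (simp add: M.smult_assoc comm M.rsmult_assoc M.smult_rsmult)
  then show ?thesis
    using x by (auto simp: balanced_map_def M.smult_l_distr M.rsmult_l_distr M.rsmult_r_distr)
qed

lemma can_map_pure:
  assumes "bimodule A A M" "x \<in> carrier M"
    and "\<And>t. t \<in> carrier T \<Longrightarrow> t \<odot>\<^bsub>M\<^esub> x = rsmult M x t"
    and "a \<in> carrier A" "b \<in> carrier A"
  shows "can_map M x (a \<boxtimes> b) = rsmult M (a \<odot>\<^bsub>M\<^esub> x) b"
proof -
  interpret M: bimodule A A M by fact
  show ?thesis
    unfolding can_map_def
    using AA.tensor_lift_elem[OF M.abelian_group_axioms can_map_balanced[OF assms(1-3)]] assms(4,5) by simp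
qed

text \<open>
  Both sides are additive and send \<open>a \<otimes> b\<close> to \<open>a (f x) b\<close>, as \<open>f\<close> is a bimodule map. Applied to a cofree
  family, this yields \<open>can\<^sub>\<alpha> = \<gamma>\<^sub>\<alpha> \<circ> can\<^sub>e\<close>.
\<close>

lemma can_map_natural:
  assumes M: "bimodule A A M" and N: "bimodule A A N" and x: "x \<in> carrier M"
    and f: "f \<in> bimodule_hom A A M N"
    and comm: "\<And>t. t \<in> carrier T \<Longrightarrow> t \<odot>\<^bsub>M\<^esub> x = rsmult M x t"
    and d: "d \<in> carrier D"
  shows "f (can_map M x d) = can_map N (f x) d"
proof -
  interpret M: bimodule A A M by fact
  interpret N: bimodule A A N by fact
  have fx: "f x \<in> carrier N" using f x by (rule bimodule_hom_closed)
  have fl: "f (r \<odot>\<^bsub>M\<^esub> m) = r \<odot>\<^bsub>N\<^esub> f m" and fr: "f (rsmult M m r) = rsmult N (f m) r"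
    if "r \<in> carrier A" "m \<in> carrier M" for r m
    using f that by (auto simp: bimodule_hom_def)
  have comm': "t \<odot>\<^bsub>N\<^esub> f x = rsmult N (f x) t" if "t \<in> carrier T" for t
    using comm[OF that] fl[OF T_mem[OF that] x] fr[OF T_mem[OF that] x] by simp
  have can_M: "can_map M x \<in> additive_maps D M" and can_N: "can_map N (f x) \<in> additive_maps D N"
    unfolding can_map_def
    by (intro AA.tensor_lift_additive M.abelian_group_axioms N.abelian_group_axioms
        can_map_balanced M N x fx comm comm'; assumption)+
  have "(\<lambda>d. f (can_map M x d)) \<in> additive_maps D N"
    using additive_maps_closed[OF can_M] additive_maps_add[OF can_M] bimodule_hom_closed[OF f]
      additive_maps_add[OF bimodule_hom_additive[OF f]]
    by (intro additive_mapsI) simp_all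
  then show ?thesis
    by (rule AA.additive_maps_eqI[OF N.abelian_group_axioms _ can_N _ d])
      (use x in \<open>simp add: can_map_pure[OF M x comm] can_map_pure[OF N fx comm'] fl fr\<close>)
qed

end

section \<open>Isomorphisms of bimodules\<close>

lemma bimodule_iso_hom: "f \<in> bimodule_iso R S M N \<Longrightarrow> f \<in> bimodule_hom R S M N"
  by (simp add: bimodule_iso_def)

lemma bimodule_iso_bij: "f \<in> bimodule_iso R S M N \<Longrightarrow> bij_betw f (carrier M) (carrier N)"
  by (simp add: bimodule_iso_def)

text \<open>
  The hypothesis \<open>middle_pair A M M\<close> is used for its closure properties: \<open>M\<close> is closed under addition
  and under both actions. They are needed because \<open>h\<close> is only known to be the composite on the
  carrier of \<open>M\<close>.
\<close>

lemma bimodule_iso_comp: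
  assumes M: "middle_pair A M M"
    and f: "f \<in> bimodule_iso A A M N" and g: "g \<in> bimodule_iso A A N P"
    and eq: "\<And>m. m \<in> carrier M \<Longrightarrow> h m = g (f m)"
  shows "h \<in> bimodule_iso A A M P"
proof -
  interpret M: middle_pair A M M by fact
  have "bij_betw (g \<circ> f) (carrier M) (carrier P)"
    using bimodule_iso_bij[OF f] bimodule_iso_bij[OF g] by (rule bij_betw_trans)
  then have "bij_betw h (carrier M) (carrier P)"
    by (rule bij_betw_cong[THEN iffD1, rotated]) (simp add: eq)
  moreover have "h \<in> bimodule_hom A A M P"
    using bimodule_iso_hom[OF f] bimodule_iso_hom[OF g]
    by (simp add: bimodule_hom_def Pi_iff eq M.inner_smult_closed M.inner_rsmult_closed)
  ultimately show ?thesis by (simp add: bimodule_iso_def)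
qed

lemma bimodule_iso_inv:
  assumes M: "middle_pair A M M" and f: "f \<in> bimodule_iso A A M N"
    and N: "middle_pair A N N"
  shows "inv_into (carrier M) f \<in> bimodule_iso A A N M"
proof -
  interpret M: middle_pair A M M by fact
  interpret N: middle_pair A N N by fact
  let ?g = "inv_into (carrier M) f"
  note bij = bimodule_iso_bij[OF f]
  have gc: "?g n \<in> carrier M" if "n \<in> carrier N" for n
    using bij_betw_inv_into[OF bij] that by (rule bij_betw_apply)
  have fg: "f (?g n) = n" if "n \<in> carrier N" for n
    using bij_betw_inv_into_right[OF bij that] .
  have gI: "?g n = m" if "m \<in> carrier M" "f m = n" for m n
    using bij_betw_inv_into_left[OF bij that(1)] that(2) by simp
  have "?g \<in> bimodule_hom A A N M"
    using bimodule_iso_hom[OF f] gc fg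
    unfolding bimodule_hom_def
    by (auto intro!: gI M.inner_smult_closed M.inner_rsmult_closed)
  then show ?thesis using bij_betw_inv_into[OF bij] by (simp add: bimodule_iso_def)
qed

section \<open>Galois group corings\<close>

lemma coinvariants_transport:
  assumes f: "f \<in> bimodule_hom A A M N" and x: "x \<in> carrier M" and a: "a \<in> carrier A"
    and comm: "a \<odot>\<^bsub>M\<^esub> x = rsmult M x a"
  shows "a \<odot>\<^bsub>N\<^esub> f x = rsmult N (f x) a"
proof -
  have "a \<odot>\<^bsub>N\<^esub> f x = f (a \<odot>\<^bsub>M\<^esub> x)" "rsmult N (f x) a = f (rsmult M x a)"
    using f x a by (auto simp: bimodule_hom_def)
  then show ?thesis using comm by simp
qed

text \<open>
  The isomorphisms \<open>\<gamma>\<^sub>\<alpha>\<close> carry the commutation of \<open>a\<close> with \<open>x\<^sub>e\<close> over to \<open>x\<^sub>\<alpha> = \<gamma>\<^sub>\<alpha>(x\<^sub>e)\<close>, so that the condition at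
  the unit implies all the others: \<open>T = T\<^sub>e\<close>.
\<close>

lemma cofree_coinvariants:
  assumes C: "group_coring G A C" and x: "grouplike_family G A C x"
    and cofree: "cofree_group_coring G A C x"
  shows "group_coinvariants G A C x = coinvariants A (unit_coring G C) (x \<one>\<^bsub>G\<^esub>)"
proof -
  interpret C: group_coring G A C by fact
  obtain \<gamma> where iso: "\<And>\<alpha>. \<alpha> \<in> carrier G \<Longrightarrow>
      \<gamma> \<alpha> \<in> bimodule_iso A A (gcomponent C \<one>\<^bsub>G\<^esub>) (gcomponent C \<alpha>)"
    and \<gamma>x: "\<And>\<alpha>. \<alpha> \<in> carrier G \<Longrightarrow> x \<alpha> = \<gamma> \<alpha> (x \<one>\<^bsub>G\<^esub>)"
    using cofree unfolding cofree_group_coring_def by blast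
  have xe: "x \<one>\<^bsub>G\<^esub> \<in> carrier (gcomponent C \<one>\<^bsub>G\<^esub>)"
    using x by (simp add: grouplike_family_def)
  have "a \<odot>\<^bsub>gcomponent C \<alpha>\<^esub> x \<alpha> = rsmult (gcomponent C \<alpha>) (x \<alpha>) a"
    if "a \<in> carrier A" "\<alpha> \<in> carrier G"
      "a \<odot>\<^bsub>gcomponent C \<one>\<^bsub>G\<^esub>\<^esub> x \<one>\<^bsub>G\<^esub> = rsmult (gcomponent C \<one>\<^bsub>G\<^esub>) (x \<one>\<^bsub>G\<^esub>) a" for a \<alpha>
    unfolding \<gamma>x[OF that(2)]
    using bimodule_iso_hom[OF iso[OF that(2)]] xe that(1,3) by (rule coinvariants_transport)
  then have "{a \<in> carrier A. \<forall>\<alpha>\<in>carrier G. a \<odot>\<^bsub>gcomponent C \<alpha>\<^esub> x \<alpha> = rsmult (gcomponent C \<alpha>) (x \<alpha>) a} =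
      {a \<in> carrier A. a \<odot>\<^bsub>gcomponent C \<one>\<^bsub>G\<^esub>\<^esub> x \<one>\<^bsub>G\<^esub> = rsmult (gcomponent C \<one>\<^bsub>G\<^esub>) (x \<one>\<^bsub>G\<^esub>) a}"
    by auto
  then show ?thesis
    by (simp add: group_coinvariants_def coinvariants_def unit_coring_def)
qed

text \<open>
  This criterion and the next one put the two Galois properties into the same shape, in which the
  second is visibly the part of the first at \<open>\<alpha> = \<beta> = e\<close> once the two Sweedler corings agree.
\<close>

lemma galois_group_coring_iff:
  "galois_group_coring G A C x \<longleftrightarrow>
    (let D = sweedler_coring A (group_coinvariants G A C x); can = \<lambda>\<alpha>. can_map (gcomponent C \<alpha>) (x \<alpha>) in
     (\<forall>\<alpha>\<in>carrier G. can \<alpha> \<in> bimodule_iso A A (cobimod D) (gcomponent C \<alpha>)) \<and>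
     (\<forall>\<alpha>\<in>carrier G. \<forall>\<beta>\<in>carrier G. \<forall>d\<in>carrier (cobimod D).
        tensor_map A (gcomponent C \<alpha>) (gcomponent C \<beta>) (can \<alpha>) (can \<beta>) (comult D d) =
        gcomult C \<alpha> \<beta> (can (\<alpha> \<otimes>\<^bsub>G\<^esub> \<beta>) d)) \<and>
     (\<forall>d\<in>carrier (cobimod D). gcounit C (can \<one>\<^bsub>G\<^esub> d) = counit D d))"
  by (simp add: galois_group_coring_def group_coring_iso_def coring_copies_def Let_def)

lemma galois_unit_coring_iff:
  "galois_coring A (unit_coring G C) (x \<one>\<^bsub>G\<^esub>) \<longleftrightarrow>
    (let D = sweedler_coring A (coinvariants A (unit_coring G C) (x \<one>\<^bsub>G\<^esub>));
         can = can_map (gcomponent C \<one>\<^bsub>G\<^esub>) (x \<one>\<^bsub>G\<^esub>) in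
     can \<in> bimodule_iso A A (cobimod D) (gcomponent C \<one>\<^bsub>G\<^esub>) \<and>
     (\<forall>d\<in>carrier (cobimod D).
        tensor_map A (gcomponent C \<one>\<^bsub>G\<^esub>) (gcomponent C \<one>\<^bsub>G\<^esub>) can can (comult D d) =
        gcomult C \<one>\<^bsub>G\<^esub> \<one>\<^bsub>G\<^esub> (can d)) \<and>
     (\<forall>d\<in>carrier (cobimod D). gcounit C (can d) = counit D d))"
  by (auto simp: galois_coring_def coring_iso_def unit_coring_def Let_def)

theorem proposition5p10:
  fixes G :: "'g monoid" and A :: "'a ring"
    and C :: "('g, 'a, 'c) group_coring" and x :: "'g \<Rightarrow> 'c"
  assumes "group_coring G A C" and "grouplike_family G A C x"
  shows "galois_group_coring G A C x \<longleftrightarrow>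
    cofree_group_coring G A C x \<and> galois_coring A (unit_coring G C) (x \<one>\<^bsub>G\<^esub>)"
proof -
  interpret C: group_coring G A C by fact
  let ?C = "gcomponent C" and ?e = "\<one>\<^bsub>G\<^esub>"
  let ?T = "group_coinvariants G A C x"
  let ?can = "\<lambda>\<alpha>. can_map (?C \<alpha>) (x \<alpha>)"
  interpret T: sweedler A ?T
    by unfold_locales (auto simp: group_coinvariants_def)
  let ?\<Delta> = "comult (sweedler_coring A ?T)"
  note bim = C.component_bimodule
  have pair: "middle_pair A (?C \<alpha>) (?C \<beta>)" if "\<alpha> \<in> carrier G" "\<beta> \<in> carrier G" for \<alpha> \<beta>
    using bim[OF that(1)] bim[OF that(2)] by (rule bimodule_middle_pair)
  have e: "?e \<in> carrier G" by simp
  have xc: "x \<alpha> \<in> carrier (?C \<alpha>)" if "\<alpha> \<in> carrier G" for \<alpha>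
    using assms(2) that by (simp add: grouplike_family_def)
  have comm: "t \<odot>\<^bsub>?C \<alpha>\<^esub> x \<alpha> = rsmult (?C \<alpha>) (x \<alpha>) t" if "\<alpha> \<in> carrier G" "t \<in> carrier ?T" for \<alpha> t
    using that by (simp add: group_coinvariants_def)
  have can_one: "?can \<alpha> (T.pure \<one>\<^bsub>A\<^esub> \<one>\<^bsub>A\<^esub>) = x \<alpha>" if \<alpha>: "\<alpha> \<in> carrier G" for \<alpha>
  proof -
    interpret C\<alpha>: bimodule A A "?C \<alpha>" using \<alpha> by (rule bim)
    show ?thesis
      using T.can_map_pure[OF bim[OF \<alpha>] xc[OF \<alpha>] comm[OF \<alpha>]] xc[OF \<alpha>] by simp
  qed
  \<comment> \<open>Functoriality, for any family \<open>\<gamma>\<close> with \<open>can\<^sub>\<alpha> = \<gamma>\<^sub>\<alpha> \<circ> can\<^sub>e\<close>: the link between the two comultiplication laws.\<close>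
  have comult_comp: "tensor_map A (?C \<alpha>) (?C \<beta>) (\<gamma> \<alpha>) (\<gamma> \<beta>)
        (tensor_map A (?C ?e) (?C ?e) (?can ?e) (?can ?e) (?\<Delta> d)) =
      tensor_map A (?C \<alpha>) (?C \<beta>) (?can \<alpha>) (?can \<beta>) (?\<Delta> d)"
    if \<gamma>: "\<And>\<alpha>. \<alpha> \<in> carrier G \<Longrightarrow> \<gamma> \<alpha> \<in> bimodule_iso A A (?C ?e) (?C \<alpha>)"
      and can: "\<And>\<alpha>. \<alpha> \<in> carrier G \<Longrightarrow> ?can \<alpha> \<in> bimodule_iso A A T.D (?C \<alpha>)"
      and \<gamma>can: "\<And>\<alpha> d. \<lbrakk>\<alpha> \<in> carrier G; d \<in> carrier T.D\<rbrakk> \<Longrightarrow> \<gamma> \<alpha> (?can ?e d) = ?can \<alpha> d"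
      and \<alpha>: "\<alpha> \<in> carrier G" and \<beta>: "\<beta> \<in> carrier G" and d: "d \<in> carrier T.D" for \<gamma> \<alpha> \<beta> d
    by (rule tensor_map_comp[OF T.DD.middle_pair_axioms pair[OF e e] pair[OF \<alpha> \<beta>]
        can[OF e, THEN bimodule_iso_hom] can[OF e, THEN bimodule_iso_hom]
        \<gamma>[OF \<alpha>, THEN bimodule_iso_hom] \<gamma>[OF \<beta>, THEN bimodule_iso_hom]
        can[OF \<alpha>, THEN bimodule_iso_hom] can[OF \<beta>, THEN bimodule_iso_hom]
        \<gamma>can[OF \<alpha>] \<gamma>can[OF \<beta>] T.comult_closed[OF d]])
  show ?thesis
  proof
    assume gal: "galois_group_coring G A C x"
    then have can: "\<And>\<alpha>. \<alpha> \<in> carrier G \<Longrightarrow> ?can \<alpha> \<in> bimodule_iso A A T.D (?C \<alpha>)"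
      and can_comult: "\<And>\<alpha> \<beta> d. \<lbrakk>\<alpha> \<in> carrier G; \<beta> \<in> carrier G; d \<in> carrier T.D\<rbrakk> \<Longrightarrow>
        tensor_map A (?C \<alpha>) (?C \<beta>) (?can \<alpha>) (?can \<beta>) (?\<Delta> d) = gcomult C \<alpha> \<beta> (?can (\<alpha> \<otimes>\<^bsub>G\<^esub> \<beta>) d)"
      and can_counit: "\<And>d. d \<in> carrier T.D \<Longrightarrow>
        gcounit C (?can ?e d) = counit (sweedler_coring A ?T) d"
      by (simp_all add: galois_group_coring_iff T.cobimod_sweedler Let_def)
    let ?inv = "inv_into (carrier T.D) (?can ?e)"
    \<comment> \<open>The only possible choice, since \<open>can\<^sub>\<alpha> = \<gamma>\<^sub>\<alpha> \<circ> can\<^sub>e\<close> has to hold.\<close>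
    define \<gamma> where "\<gamma> = (\<lambda>\<alpha> c. ?can \<alpha> (?inv c))"
    note bij = bimodule_iso_bij[OF can[OF e]]
    have inv: "?inv \<in> bimodule_iso A A (?C ?e) T.D"
      by (rule bimodule_iso_inv[OF T.DD.middle_pair_axioms can[OF e] pair[OF e e]])
    have \<gamma>: "\<gamma> \<alpha> \<in> bimodule_iso A A (?C ?e) (?C \<alpha>)" if "\<alpha> \<in> carrier G" for \<alpha>
      by (rule bimodule_iso_comp[OF pair[OF e e] inv can[OF that]]) (simp add: \<gamma>_def)
    have \<gamma>can: "\<gamma> \<alpha> (?can ?e d) = ?can \<alpha> d" if "\<alpha> \<in> carrier G" "d \<in> carrier T.D" for \<alpha> d
      using bij_betw_inv_into_left[OF bij that(2)] by (simp add: \<gamma>_def)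
    have "gcomult C \<alpha> \<beta> (\<gamma> (\<alpha> \<otimes>\<^bsub>G\<^esub> \<beta>) c) =
        tensor_map A (?C \<alpha>) (?C \<beta>) (\<gamma> \<alpha>) (\<gamma> \<beta>) (gcomult C ?e ?e c)"
      if \<alpha>: "\<alpha> \<in> carrier G" and \<beta>: "\<beta> \<in> carrier G" and c: "c \<in> carrier (?C ?e)" for \<alpha> \<beta> c
    proof -
      obtain d where d: "d \<in> carrier T.D" "c = ?can ?e d"
        using bij c by (auto simp: bij_betw_def)
      have "tensor_map A (?C \<alpha>) (?C \<beta>) (\<gamma> \<alpha>) (\<gamma> \<beta>) (gcomult C ?e ?e c) =
          tensor_map A (?C \<alpha>) (?C \<beta>) (\<gamma> \<alpha>) (\<gamma> \<beta>)
            (tensor_map A (?C ?e) (?C ?e) (?can ?e) (?can ?e) (?\<Delta> d))"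
        using can_comult[OF e e d(1)] d(2) by simp
      also have "\<dots> = tensor_map A (?C \<alpha>) (?C \<beta>) (?can \<alpha>) (?can \<beta>) (?\<Delta> d)"
        using \<gamma> can \<gamma>can \<alpha> \<beta> d(1) by (rule comult_comp)
      also have "\<dots> = gcomult C \<alpha> \<beta> (\<gamma> (\<alpha> \<otimes>\<^bsub>G\<^esub> \<beta>) c)"
        using can_comult[OF \<alpha> \<beta> d(1)] \<gamma>can[of "\<alpha> \<otimes>\<^bsub>G\<^esub> \<beta>" d] \<alpha> \<beta> d by simp
      finally show ?thesis ..
    qed
    \<comment> \<open>Both \<open>x\<^sub>e\<close> and \<open>x\<^sub>\<alpha>\<close> are images of \<open>1 \<otimes> 1\<close>.\<close>
    moreover have "x \<alpha> = \<gamma> \<alpha> (x ?e)" if \<alpha>: "\<alpha> \<in> carrier G" for \<alpha>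
      using \<gamma>can[OF \<alpha>, of "T.pure \<one>\<^bsub>A\<^esub> \<one>\<^bsub>A\<^esub>"] can_one[OF e] can_one[OF \<alpha>] by simp
    ultimately have cofree: "cofree_group_coring G A C x"
      unfolding cofree_group_coring_def using \<gamma> by (intro exI[of _ \<gamma>] conjI ballI)
    \<comment> \<open>Cofreeness is established first because it gives \<open>T = T\<^sub>e\<close>.\<close>
    have "galois_coring A (unit_coring G C) (x ?e)"
      using can[OF e] can_comult[OF e e] can_counit
      by (simp add: galois_unit_coring_iff cofree_coinvariants[OF assms cofree, symmetric]
          T.cobimod_sweedler Let_def)
    with cofree show "cofree_group_coring G A C x \<and> galois_coring A (unit_coring G C) (x ?e)" ..
  next
    assume r: "cofree_group_coring G A C x \<and> galois_coring A (unit_coring G C) (x ?e)"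
    then have cofree: "cofree_group_coring G A C x" ..
    then obtain \<gamma> where \<gamma>: "\<And>\<alpha>. \<alpha> \<in> carrier G \<Longrightarrow> \<gamma> \<alpha> \<in> bimodule_iso A A (?C ?e) (?C \<alpha>)"
      and \<gamma>_comult: "\<And>\<alpha> \<beta> c. \<lbrakk>\<alpha> \<in> carrier G; \<beta> \<in> carrier G; c \<in> carrier (?C ?e)\<rbrakk> \<Longrightarrow>
        gcomult C \<alpha> \<beta> (\<gamma> (\<alpha> \<otimes>\<^bsub>G\<^esub> \<beta>) c) =
        tensor_map A (?C \<alpha>) (?C \<beta>) (\<gamma> \<alpha>) (\<gamma> \<beta>) (gcomult C ?e ?e c)"
      and \<gamma>x: "\<And>\<alpha>. \<alpha> \<in> carrier G \<Longrightarrow> x \<alpha> = \<gamma> \<alpha> (x ?e)"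
      unfolding cofree_group_coring_def by blast
    have can_e: "?can ?e \<in> bimodule_iso A A T.D (?C ?e)"
      and can_e_comult: "\<And>d. d \<in> carrier T.D \<Longrightarrow>
        tensor_map A (?C ?e) (?C ?e) (?can ?e) (?can ?e) (?\<Delta> d) = gcomult C ?e ?e (?can ?e d)"
      and can_e_counit: "\<And>d. d \<in> carrier T.D \<Longrightarrow>
        gcounit C (?can ?e d) = counit (sweedler_coring A ?T) d"
      using r
      by (simp_all add: galois_unit_coring_iff cofree_coinvariants[OF assms cofree, symmetric]
          T.cobimod_sweedler Let_def)
    have \<gamma>can: "\<gamma> \<alpha> (?can ?e d) = ?can \<alpha> d" if "\<alpha> \<in> carrier G" "d \<in> carrier T.D" for \<alpha> d
      using T.can_map_natural[OF bim[OF e] bim[OF that(1)] xc[OF e]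
          bimodule_iso_hom[OF \<gamma>[OF that(1)]] comm[OF e] that(2)] \<gamma>x[OF that(1)] by simp
    have can: "?can \<alpha> \<in> bimodule_iso A A T.D (?C \<alpha>)" if "\<alpha> \<in> carrier G" for \<alpha>
      by (rule bimodule_iso_comp[OF T.DD.middle_pair_axioms can_e \<gamma>[OF that]])
        (simp add: \<gamma>can[OF that])
    have "tensor_map A (?C \<alpha>) (?C \<beta>) (?can \<alpha>) (?can \<beta>) (?\<Delta> d) = gcomult C \<alpha> \<beta> (?can (\<alpha> \<otimes>\<^bsub>G\<^esub> \<beta>) d)"
      if \<alpha>: "\<alpha> \<in> carrier G" and \<beta>: "\<beta> \<in> carrier G" and d: "d \<in> carrier T.D" for \<alpha> \<beta> d
    proof -
      have "tensor_map A (?C \<alpha>) (?C \<beta>) (?can \<alpha>) (?can \<beta>) (?\<Delta> d) =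
          tensor_map A (?C \<alpha>) (?C \<beta>) (\<gamma> \<alpha>) (\<gamma> \<beta>)
            (tensor_map A (?C ?e) (?C ?e) (?can ?e) (?can ?e) (?\<Delta> d))"
        using \<gamma> can \<gamma>can \<alpha> \<beta> d by (rule comult_comp[symmetric])
      also have "\<dots> = gcomult C \<alpha> \<beta> (\<gamma> (\<alpha> \<otimes>\<^bsub>G\<^esub> \<beta>) (?can ?e d))"
        using \<gamma>_comult[OF \<alpha> \<beta> bimodule_hom_closed[OF bimodule_iso_hom[OF can_e] d]]
        by (simp only: can_e_comult[OF d])
      also have "\<dots> = gcomult C \<alpha> \<beta> (?can (\<alpha> \<otimes>\<^bsub>G\<^esub> \<beta>) d)"
        using \<gamma>can[of "\<alpha> \<otimes>\<^bsub>G\<^esub> \<beta>" d] \<alpha> \<beta> d by simp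
      finally show ?thesis .
    qed
    then show "galois_group_coring G A C x"
      using can can_e_counit by (simp add: galois_group_coring_iff T.cobimod_sweedler Let_def)
  qed
qed

end
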